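(* Let $q$ be a prime power, let $n$ be an integer with $2\leqslant n\leqslant q+2$, and let $k=2+(n-1)(q-1)$. Then the slopes of $M(0,n,q,t)$ are $1$ and $\frac{k}{2}$. Moreover, the matrix $M(0,n,q,t)$ is diagonalizable over $\mathbb{C}_\infty$ if and only if either $q$ is odd, or $q$ is even and $n\leqslant 3$.
   Context: Let $q$ be a power of a prime $p$, $F=\mathbb{F}_q(t)$, and let $\mathbb{C}_\infty$ be the completion of an algebraic closure of $\mathbb{F}_q((1/t))$. For an integer $n\geqslant 2$, $M(0,n,q)=(m_{a,b})_{1\leqslant a,b\leqslant n}$ is the $n\times n$ matrix over $\mathbb{F}_p$ with entries (binomial coefficients reduced modulo $p$, with $\binom{x}{y}=0$ for integers $0\leqslant x<y$) $$m_{a,b}=-\left[\binom{(n-a)(q-1)}{(n-b)(q-1)}-\binom{(n-a)(q-1)}{(b-1)(q-1)}\right]\ \text{ if } a\neq b,\qquad m_{a,a}=\binom{(n-a)(q-1)}{(a-1)(q-1)}.$$ $M(0,n,q,t)$ is the $n\times n$ matrix over $\mathbb{F}_q[t]$ whose $(a,b)$ entry is $m_{a,b}\,t^{\,1+(b-1)(q-1)}$. (It is the matrix of the Atkin operator $U_t$, normalized by a power of $t$, acting on a block of $\Gamma_0(t)$-invariant Drinfeld cusp forms of weight $k=2+(n-1)(q-1)$.) The slopes are the values $v_t(\lambda)$ for the nonzero eigenvalues $\lambda$ of $M(0,n,q,t)$ in an algebraic closure of $F$, where $v_t$ is (an extension of) the $t$-adic valuation with $v_t(t)=1$.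
   Formalization: For n = 2 the matrix is [[t,0],[t,0]], with eigenvalues t and 0, so k/2 = (q+1)/2 is not a slope; the formal statement says the slopes are exactly 1 when n = 2, and exactly 1 and k/2 when 3 ≤ n ≤ q+2. *)

theory Defs
  imports
    "HOL-Analysis.Analysis"
    "HOL-Computational_Algebra.Formal_Laurent_Series"
    "HOL-Computational_Algebra.Polynomial_Factorial"
    "HOL-Number_Theory.Prime_Powers"
    "HOL-Algebra.Algebraic_Closure_Type"
    "Jordan_Normal_Form.Char_Poly"
begin

text \<open>
  Throughout, \<open>'f\<close> is the finite field with \<open>q\<close> elements, \<open>'f poly\<close> is the polynomial ring in
  the variable \<open>t\<close>, \<open>'f poly fract\<close> is the rational function field, and \<open>'f fls\<close> is the field
  of formal Laurent series in the uniformizer \<open>1/t\<close> (so \<open>t\<close> itself is \<^const>\<open>fls_X_inv\<close>).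
\<close>

text \<open>
  The indices \<open>a\<close>, \<open>b\<close> range over \<open>{1..n}\<close>, so the truncated subtractions are exact.  The
  coercion \<^const>\<open>of_nat\<close> into a field of characteristic \<open>p\<close> is the reduction modulo \<open>p\<close>.
\<close>

definition atkin_coeff :: "nat \<Rightarrow> nat \<Rightarrow> nat \<Rightarrow> nat \<Rightarrow> 'a :: comm_ring_1" where
  "atkin_coeff n q a b =
     (if a = b
      then of_nat (((n - a) * (q - 1)) choose ((a - 1) * (q - 1)))
      else - (of_nat (((n - a) * (q - 1)) choose ((n - b) * (q - 1)))
              - of_nat (((n - a) * (q - 1)) choose ((b - 1) * (q - 1)))))"

text \<open>Matrices of type \<^typ>\<open>'a mat\<close> are indexed from 0, whence the shifts \<open>a = i + 1\<close>, \<open>b = j + 1\<close>.\<close>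

definition atkin_mat :: "nat \<Rightarrow> nat \<Rightarrow> 'a :: comm_ring_1 poly mat" where
  "atkin_mat n q =
     mat n n (\<lambda>(i, j).
       Polynomial.monom (atkin_coeff n q (i + 1) (j + 1)) (1 + ((j + 1) - 1) * (q - 1)))"

definition diagonalizable_mat :: "'a :: field mat \<Rightarrow> bool" where
  "diagonalizable_mat A \<longleftrightarrow> (\<exists>D. similar_mat A D \<and> diagonal_mat D)"

text \<open>
  An extension to the algebraic closure of the \<open>t\<close>-adic valuation of the rational function field,
  as a real-valued function on nonzero elements; its value at 0 is irrelevant.  The number
  \<open>Polynomial.order 0 a\<close> is the exact power of \<open>t\<close> dividing \<open>a\<close>.
\<close>

definition extends_t_adic_valuation :: "('f :: field poly fract alg_closure \<Rightarrow> real) \<Rightarrow> bool" where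
  "extends_t_adic_valuation v \<longleftrightarrow>
     (\<forall>x y. x \<noteq> 0 \<longrightarrow> y \<noteq> 0 \<longrightarrow> v (x * y) = v x + v y) \<and>
     (\<forall>x y. x \<noteq> 0 \<longrightarrow> y \<noteq> 0 \<longrightarrow> x + y \<noteq> 0 \<longrightarrow> min (v x) (v y) \<le> v (x + y)) \<and>
     (\<forall>a b. a \<noteq> 0 \<longrightarrow> b \<noteq> 0 \<longrightarrow>
        v (to_ac (Fract a b)) = real (Polynomial.order 0 a) - real (Polynomial.order 0 b))"

definition slopes :: "('f :: field poly fract alg_closure \<Rightarrow> real) \<Rightarrow> 'f poly mat \<Rightarrow> real set" where
  "slopes v A =
     {v x |x. eigenvalue (map_mat (\<lambda>a. to_ac (to_fract a)) A) x \<and> x \<noteq> 0}"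

text \<open>
  The standard absolute value at infinity, normalized by \<open>\<bar>t\<bar> = q\<close>.
\<close>

definition abs_infty :: "'f :: {field, finite} fls \<Rightarrow> real" where
  "abs_infty x = (if x = 0 then 0 else real CARD('f) powi (- fls_subdegree x))"

text \<open>
  The metric field \<open>'c\<close>, with the embedding \<open>\<iota>\<close> of the algebraic closure of the Laurent series
  field, is its completion: the metric comes from a multiplicative ultrametric absolute value
  \<open>x \<mapsto> dist x 0\<close> extending \<^const>\<open>abs_infty\<close>, the image of \<open>\<iota>\<close> is dense, and \<open>'c\<close> is complete
  by its type class.  This determines \<open>(\<iota>, 'c)\<close> up to an isometric isomorphism, because
  \<^const>\<open>abs_infty\<close> extends uniquely to the algebraic closure.
\<close>

definition is_C_infty ::
  "('f :: {field, finite} fls alg_closure \<Rightarrow> 'c :: {field, complete_space}) \<Rightarrow> bool" where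
  "is_C_infty \<iota> \<longleftrightarrow>
     field_hom \<iota> \<and>
     (\<forall>x y :: 'c. dist x y = dist (x - y) 0) \<and>
     (\<forall>x y :: 'c. dist (x * y) 0 = dist x 0 * dist y 0) \<and>
     (\<forall>x y :: 'c. dist (x + y) 0 \<le> max (dist x 0) (dist y 0)) \<and>
     (\<forall>x. dist (\<iota> (to_ac x)) 0 = abs_infty x) \<and>
     closure (range \<iota>) = UNIV"

definition poly_to_C_infty ::
  "('f :: {field, finite} fls alg_closure \<Rightarrow> 'c :: {field, complete_space}) \<Rightarrow> 'f poly \<Rightarrow> 'c" where
  "poly_to_C_infty \<iota> a = \<iota> (to_ac (poly (map_poly fls_const a) fls_X_inv))"

end

theory Submission
  imports Defs "HOL-Number_Theory.Residues"
begin

text \<open>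
  For \<open>n \<le> q + 2\<close> the binomial coefficients reduce modulo \<open>p\<close> to \<open>0\<close> or \<open>1\<close>, and the matrix becomes
  sparse: its first and last rows are \<open>t e\<^sub>1\<close>, and its \<open>a\<close>-th row is
  \<open>w\<^sub>1 e\<^sub>1 + w\<^sub>b e\<^sub>b - w\<^sub>n e\<^sub>n\<close>
  with \<open>b = n + 1 - a\<close>, where \<open>w\<^sub>j = t ^ (1 + (j - 1) (q - 1))\<close>.  So the eigenvalues are \<open>t\<close> and \<open>0\<close>,
  both simple, and those of the reversal \<open>e\<^sub>a \<mapsto> w\<^sub>a e\<^sub>b\<close> of the middle block, which are the square roots of
  \<open>w\<^sub>a w\<^sub>b = t ^ k\<close>.  In odd characteristic the two roots differ and there is an explicit basis of
  eigenvectors.  In characteristic \<open>2\<close> they coincide, and a pair \<open>a \<noteq> b\<close>, which exists iff \<open>n \<ge> 4\<close>,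
  gives a Jordan block of size \<open>2\<close>.
\<close>

section \<open>Binomial coefficients in prime characteristic\<close>

lemma coeff_one_plus_X_power:
  "Polynomial.coeff ([:1, 1:] ^ n) i = (of_nat (n choose i) :: 'a :: comm_ring_1)"
proof (cases "i \<le> n")
  case False
  have "Polynomial.degree ([:1, 1 :: 'a:] ^ n) \<le> Polynomial.degree [:1, 1 :: 'a:] * n"
    by (rule degree_power_le)
  also have "\<dots> < i"
    using False by simp
  finally show ?thesis
    using False by (simp add: Polynomial.coeff_eq_0 binomial_eq_0)
qed (simp add: coeff_linear_poly_power)

text \<open>By the freshman's dream \<open>(1 + X) ^ q = 1 + X ^ q\<close>, so multiplying
  \<open>(1 + X) ^ x\<close> by \<open>(1 + X) ^ q\<close> adds a copy shifted by \<open>q\<close>;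
  the coefficients of \<open>X ^ m\<close> are compared.\<close>

lemma of_nat_choose_add_prime_power:
  assumes "Factorial_Ring.prime CHAR('a :: comm_ring_1)" and "q = CHAR('a) ^ e"
  shows "(of_nat ((x + q) choose m) :: 'a) =
    of_nat (x choose m) + (if q \<le> m then of_nat (x choose (m - q)) else 0)"
proof -
  have "([:1, 1:] :: 'a poly) ^ q = ([:1:] + Polynomial.monom 1 1) ^ q"
    by (simp add: Polynomial.monom_altdef one_pCons)
  also have "\<dots> = [:1:] ^ q + Polynomial.monom 1 1 ^ q"
    by (rule freshmans_dream') (use assms in auto)
  finally have "([:1, 1:] :: 'a poly) ^ (x + q) =
      [:1, 1:] ^ x + Polynomial.monom 1 q * [:1, 1:] ^ x"
    by (simp add: power_add algebra_simps Polynomial.monom_power one_pCons flip: one_pCons)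
  hence "Polynomial.coeff (([:1, 1:] :: 'a poly) ^ (x + q)) m =
      Polynomial.coeff ([:1, 1:] ^ x) m + Polynomial.coeff (Polynomial.monom 1 q * [:1, 1:] ^ x) m"
    by simp
  thus ?thesis
    by (simp add: coeff_one_plus_X_power Polynomial.coeff_monom_mult split: if_splits)
qed

text \<open>The vanishing part of Lucas' theorem for the last base-\<open>q\<close> digit. Each
  \<open>q\<close> removed from the top keeps \<open>m\<close> or replaces it by
  \<open>m - q\<close>, and neither changes \<open>m mod q\<close>.\<close>

lemma of_nat_choose_eq_0_if_mod_less:
  assumes "Factorial_Ring.prime CHAR('a :: comm_ring_1)" and "q = CHAR('a) ^ e" and "b < m mod q"
  shows "(of_nat ((a * q + b) choose m) :: 'a) = 0"
  using assms(3)
proof (induction a arbitrary: m)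
  case 0
  have "m mod q \<le> m"
    by simp
  with 0 have "b < m"
    by linarith
  thus ?case
    by (simp add: binomial_eq_0)
next
  case (Suc a)
  have eq: "Suc a * q + b = (a * q + b) + q"
    by simp
  have "b < (m - q) mod q" if "q \<le> m"
    using Suc.prems le_mod_geq[OF that] by simp
  thus ?case
    unfolding eq of_nat_choose_add_prime_power[OF assms(1,2)]
    using Suc.prems Suc.IH[of m] Suc.IH[of "m - q"] by simp
qed

text \<open>Inner entries of row \<open>q\<close> of Pascal's triangle vanish, so neighbours in row
  \<open>q - 1\<close> are negatives of each other.\<close>

lemma of_nat_choose_prime_power_minus_1:
  assumes "Factorial_Ring.prime CHAR('a :: comm_ring_1)" and "q = CHAR('a) ^ e" and "m < q"
  shows "(of_nat ((q - 1) choose m) :: 'a) = (- 1) ^ m"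
  using assms(3)
proof (induction m)
  case (Suc m)
  have "(of_nat ((0 + q) choose Suc m) :: 'a) = 0"
    unfolding of_nat_choose_add_prime_power[OF assms(1,2)] using Suc.prems by simp
  moreover have "q choose Suc m = ((q - 1) choose m) + ((q - 1) choose Suc m)"
    using Suc.prems by (cases q) auto
  ultimately have "(of_nat ((q - 1) choose m) + of_nat ((q - 1) choose Suc m) :: 'a) = 0"
    by simp
  hence "(of_nat ((q - 1) choose Suc m) :: 'a) = - of_nat ((q - 1) choose m)"
    by (simp add: add_eq_0_iff)
  with Suc show ?case
    by simp
qed simp

text \<open>
  Since \<open>j (q - 1) = (j - 1) q + (q - j)\<close>, the last base-\<open>q\<close> digits of \<open>j (q - 1)\<close> decrease
  with \<open>j \<le> q\<close>; for \<open>j = q + 1\<close> the upper entry is \<open>q\<^sup>2 - 1\<close>.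
\<close>

lemma of_nat_choose_multiples:
  assumes char: "Factorial_Ring.prime CHAR('a :: comm_ring_1)" "q = CHAR('a) ^ e"
    and q: "2 \<le> q" and "j \<le> q + 1" and "i \<le> q + 1"
  shows "(of_nat ((j * (q - 1)) choose (i * (q - 1))) :: 'a) = of_bool (i = 0 \<or> i = j \<or> j = q + 1)"
proof -
  consider "i = 0 \<or> i = j" | "i > j" | "0 < i" "i < j" "j \<le> q" | "0 < i" "i < j" "j = q + 1"
    using assms(4) by linarith
  thus ?thesis
  proof cases
    case 2
    hence "j * (q - 1) < i * (q - 1)"
      using q by simp
    thus ?thesis
      using 2 assms(5) by (simp add: binomial_eq_0)
  next
    case 3
    have j: "j * (q - 1) = (j - 1) * q + (q - j)"
      using 3 by (simp add: algebra_simps)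
    have "i * (q - 1) = (q - i) + (i - 1) * q"
      using 3 by (simp add: algebra_simps)
    also have "\<dots> mod q = (q - i) mod q"
      by (rule mod_mult_self1)
    also have "\<dots> = q - i"
      using 3 by simp
    finally have "(i * (q - 1)) mod q = q - i" .
    moreover have "q - j < q - i"
      using 3 by simp
    ultimately have "q - j < (i * (q - 1)) mod q"
      by simp
    hence "(of_nat ((j * (q - 1)) choose (i * (q - 1))) :: 'a) = 0"
      unfolding j by (rule of_nat_choose_eq_0_if_mod_less[OF char])
    thus ?thesis
      using 3 by simp
  next
    case 4
    have j: "j * (q - 1) = q\<^sup>2 - 1"
      using 4 by (simp add: power2_eq_square algebra_simps)
    have q2: "q\<^sup>2 = CHAR('a) ^ (2 * e)"
      by (simp add: char(2) power_mult mult.commute)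
    have "i * (q - 1) \<le> j * (q - 1)"
      using 4 by (intro mult_le_mono1) simp
    moreover have "q\<^sup>2 > 0"
      using q by simp
    ultimately have "i * (q - 1) < q\<^sup>2"
      unfolding j by linarith
    hence "(of_nat ((j * (q - 1)) choose (i * (q - 1))) :: 'a) = (- 1) ^ (i * (q - 1))"
      unfolding j by (rule of_nat_choose_prime_power_minus_1[OF char(1) q2])
    \<comment> \<open>For odd \<open>q\<close> the exponent is even; for even \<open>q\<close> the
      characteristic is 2 and the sign is trivial.\<close>
    also have "\<dots> = 1"
    proof (cases "even q")
      case True
      hence "CHAR('a) = 2"
        using char by (metis even_power two_is_prime_nat primes_dvd_imp_eq)
      hence "(- 1 :: 'a) = 1"
        by (metis add_eq_0_iff of_nat_CHAR of_nat_numeral one_add_one)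
      thus ?thesis
        by (metis power_one)
    qed auto
    finally show ?thesis
      using 4 by simp
  qed auto
qed

section \<open>Entries of the Atkin matrix\<close>

lemma CHAR_of_primepow_CARD:
  assumes "primepow CARD('f :: {field, finite})"
  obtains e where "Factorial_Ring.prime CHAR('f)" "CARD('f) = CHAR('f) ^ e"
proof -
  have p: "Factorial_Ring.prime CHAR('f)"
    by (intro prime_CHAR_semidom finite_imp_CHAR_pos) simp
  obtain p' e where pe: "Factorial_Ring.prime p'" "CARD('f) = p' ^ e"
    using assms by (auto simp: primepow_def)
  have "CHAR('f) dvd p' ^ e"
    using CHAR_dvd_CARD[where 'a='f] pe by simp
  with p pe(1) have "CHAR('f) = p'"
    using prime_dvd_power primes_dvd_imp_eq by blast
  with that p pe show ?thesis
    by simp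
qed

text \<open>Here \<open>N\<close> is \<open>n - 1\<close> and indices start at 0. Both binomials are
  indicators; their extra case \<open>i = 0\<close>, \<open>N = q + 1\<close> cancels in the
  difference off the diagonal. In row 0 the reversal term cancels against the last column, and in
  row \<open>N\<close> it merges with the first column.\<close>

lemma atkin_coeff_eq:
  assumes "Factorial_Ring.prime CHAR('a :: comm_ring_1)" "q = CHAR('a) ^ e"
    and "2 \<le> q" and "1 \<le> N" and "N \<le> q + 1" and "i \<le> N" and "j \<le> N"
  shows "(atkin_coeff (N + 1) q (i + 1) (j + 1) :: 'a) =
    of_bool (j = 0) + of_bool (0 < i \<and> i < N) * (of_bool (j = N - i) - of_bool (j = N))"
proof -
  note c = of_nat_choose_multiples[OF assms(1-3)]
  have c1: "(of_nat (((N - i) * (q - 1)) choose ((N - j) * (q - 1))) :: 'a) =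
      of_bool (j = N \<or> i = j \<or> i = 0 \<and> N = q + 1)"
    by (subst c) (use assms(4-) in auto)
  have c2: "(of_nat (((N - i) * (q - 1)) choose (j * (q - 1))) :: 'a) =
      of_bool (j = 0 \<or> j = N - i \<or> i = 0 \<and> N = q + 1)"
    by (subst c) (use assms(4-) in auto)
  have "(atkin_coeff (N + 1) q (i + 1) (j + 1) :: 'a) =
     (if i = j then of_nat (((N - i) * (q - 1)) choose (j * (q - 1)))
      else - (of_nat (((N - i) * (q - 1)) choose ((N - j) * (q - 1))) -
        of_nat (((N - i) * (q - 1)) choose (j * (q - 1)))))"
    by (auto simp: atkin_coeff_def)
  also have "\<dots> =
      of_bool (j = 0) + of_bool (0 < i \<and> i < N) * (of_bool (j = N - i) - of_bool (j = N))"
    unfolding c1 c2 using assms(4-) by (cases "i = 0"; cases "i = N"; cases "j = 0"; cases "j = N"; simp; linarith?)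
  finally show ?thesis .
qed

section \<open>Criteria for and against diagonalizability\<close>

text \<open>Spanning is phrased as: only 0 is orthogonal to all \<open>v j\<close>. Thus the
  transpose of the matrix \<open>P\<close> with columns \<open>v j\<close> has trivial kernel, so
  \<open>P\<close> is invertible and \<open>A * P = P * D\<close> diagonalizes
  \<open>A\<close>.\<close>

lemma diagonalizable_matI:
  fixes A :: "'a :: field mat"
  assumes A: "A \<in> carrier_mat n n"
    and v: "\<And>j. j < n \<Longrightarrow> v j \<in> carrier_vec n"
    and ev: "\<And>j. j < n \<Longrightarrow> A *\<^sub>v v j = d j \<cdot>\<^sub>v v j"
    and spans: "\<And>u. u \<in> carrier_vec n \<Longrightarrow> (\<And>j. j < n \<Longrightarrow> v j \<bullet> u = 0) \<Longrightarrow> u = 0\<^sub>v n"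
  shows "diagonalizable_mat A"
proof -
  define P where "P = mat n n (\<lambda>(i, j). v j $ i)"
  define D where "D = mat n n (\<lambda>(i, j). if i = j then d j else 0)"
  have P: "P \<in> carrier_mat n n" and D: "D \<in> carrier_mat n n"
    by (auto simp: P_def D_def)
  have colP: "col P j = v j" if "j < n" for j
    using that v[OF that] by (auto simp: P_def)
  have "det P\<^sup>T \<noteq> 0"
  proof
    assume "det P\<^sup>T = 0"
    then obtain u where u: "u \<in> carrier_vec n" "u \<noteq> 0\<^sub>v n" "P\<^sup>T *\<^sub>v u = 0\<^sub>v n"
      using det_0_iff_vec_prod_zero_field[of "P\<^sup>T" n] P by auto
    have "v j \<bullet> u = 0" if "j < n" for j
    proof -
      have "(P\<^sup>T *\<^sub>v u) $ j = v j \<bullet> u"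
        using that P by (simp add: colP)
      thus ?thesis
        using u(3) that by simp
    qed
    with spans u show False
      by blast
  qed
  hence "det P \<noteq> 0"
    using det_transpose[OF P] by simp
  from det_non_zero_imp_unit[OF P this, of "()"]
  obtain Q where Q: "Q \<in> carrier_mat n n" "Q * P = 1\<^sub>m n" "P * Q = 1\<^sub>m n"
    unfolding Units_def ring_mat_def by auto
  have "A * P = P * D"
  proof (rule eq_matI)
    fix i j assume "i < dim_row (P * D)" "j < dim_col (P * D)"
    hence ij: "i < n" "j < n"
      using P D by auto
    have "(A * P) $$ (i, j) = (A *\<^sub>v v j) $ i"
      using ij A P by (simp add: colP)
    also have "\<dots> = d j * P $$ (i, j)"
      using ij v[of j] by (simp add: ev P_def)
    also have "\<dots> = (\<Sum>l<n. if l = j then d j * P $$ (i, l) else 0)"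
      using ij by simp
    also have "\<dots> = (\<Sum>l<n. P $$ (i, l) * D $$ (l, j))"
      by (intro sum.cong) (use ij in \<open>auto simp: D_def\<close>)
    also have "\<dots> = (P * D) $$ (i, j)"
      using ij P D by (simp add: scalar_prod_def lessThan_atLeast0)
    finally show "(A * P) $$ (i, j) = (P * D) $$ (i, j)" .
  qed (use A P D in auto)
  hence "A = P * D * Q"
    using assoc_mult_mat[OF A P Q(1)] A by (simp add: Q)
  hence "similar_mat A D"
    using A P D Q by (intro similar_matI[of _ _ P Q n]) auto
  moreover have "diagonal_mat D"
    by (auto simp: diagonal_mat_def D_def)
  ultimately show ?thesis
    unfolding diagonalizable_mat_def by blast
qed

text \<open>With \<open>d\<close> the \<open>i\<close>-th diagonal entry of \<open>D\<close>, the
  coordinates satisfy \<open>(d - s) * (Q v)_i = (Q u)_i\<close> and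
  \<open>(d - s) * (Q u)_i = 0\<close>. The first kills \<open>(Q u)_i\<close> if
  \<open>d = s\<close>, the second otherwise.\<close>

lemma diagonalizable_mat_no_jordan_chain:
  fixes A :: "'a :: field mat"
  assumes "diagonalizable_mat A" and A: "A \<in> carrier_mat n n"
    and v: "v \<in> carrier_vec n" and u: "u \<in> carrier_vec n"
    and Av: "A *\<^sub>v v = s \<cdot>\<^sub>v v + u" and Au: "A *\<^sub>v u = s \<cdot>\<^sub>v u"
  shows "u = 0\<^sub>v n"
proof -
  obtain D where "similar_mat A D" and diag: "diagonal_mat D"
    using assms(1) unfolding diagonalizable_mat_def by blast
  then obtain m P Q where PQ: "{A, D, P, Q} \<subseteq> carrier_mat m m" "P * Q = 1\<^sub>m m" "Q * P = 1\<^sub>m m"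
      "A = P * D * Q"
    using similar_matD by blast
  hence [simp]: "m = n"
    using A by auto
  have P: "P \<in> carrier_mat n n" and Q: "Q \<in> carrier_mat n n" and D: "D \<in> carrier_mat n n"
    using PQ by auto
  have QA: "Q * A = D * Q"
  proof -
    have "Q * A = (Q * P) * (D * Q)"
      using P Q D PQ(4) by (simp add: assoc_mult_mat[of _ n n _ n _ n])
    thus ?thesis
      using PQ(3) D Q by simp
  qed
  have Qmul: "D *\<^sub>v (Q *\<^sub>v x) = Q *\<^sub>v (A *\<^sub>v x)" if "x \<in> carrier_vec n" for x
    using that QA Q D A by (metis assoc_mult_mat_vec)
  have Dmul: "(D *\<^sub>v x) $ i = D $$ (i, i) * x $ i" if "x \<in> carrier_vec n" "i < n" for x i
  proof -
    have "(D *\<^sub>v x) $ i = (\<Sum>j<n. D $$ (i, j) * x $ j)"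
      using that D by (simp add: scalar_prod_def lessThan_atLeast0)
    also have "\<dots> = (\<Sum>j\<in>{i}. D $$ (i, j) * x $ j)"
      by (rule sum.mono_neutral_right) (use that D diag in \<open>auto simp: diagonal_mat_def\<close>)
    finally show ?thesis
      by simp
  qed
  have "(Q *\<^sub>v u) $ i = 0" if i: "i < n" for i
  proof -
    have "D $$ (i, i) * (Q *\<^sub>v v) $ i = s * (Q *\<^sub>v v) $ i + (Q *\<^sub>v u) $ i"
      using Dmul[of "Q *\<^sub>v v" i] Qmul[OF v] i Q u v
      by (simp add: Av mult_add_distrib_mat_vec[OF Q] mult_mat_vec[OF Q])
    moreover have "D $$ (i, i) * (Q *\<^sub>v u) $ i = s * (Q *\<^sub>v u) $ i"
      using Dmul[of "Q *\<^sub>v u" i] Qmul[OF u] i Q u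
      by (auto simp: Au mult_mat_vec[OF Q])
    ultimately show ?thesis
      by (cases "D $$ (i, i) = s") auto
  qed
  hence Qu: "Q *\<^sub>v u = 0\<^sub>v n"
    using Q by (intro eq_vecI) auto
  have "u = P *\<^sub>v (Q *\<^sub>v u)"
    using PQ(2) P Q u by (metis \<open>m = n\<close> assoc_mult_mat_vec one_mult_mat_vec)
  also have "\<dots> = 0\<^sub>v n"
    using P by (auto simp: Qu)
  finally show ?thesis .
qed

section \<open>Eigenvectors and eigenvalues of the abstract reversal matrix\<close>

text \<open>
  The abstract shape of the Atkin matrix: \<open>w j\<close> stands for \<open>t ^ (1 + j (q - 1))\<close>, and the
  product \<open>w i * w (N - i)\<close> is \<open>t ^ k\<close> for every \<open>i\<close>.
\<close>

locale reversal_mat =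
  fixes N :: nat and w :: "nat \<Rightarrow> 'a :: field" and s :: 'a
  assumes N: "1 \<le> N"
    and w_nz: "\<And>i. w i \<noteq> 0"
    and w_w: "\<And>i. i \<le> N \<Longrightarrow> w i * w (N - i) = s ^ 2"
begin

definition A :: "'a mat" where
  "A = mat (Suc N) (Suc N) (\<lambda>(i, j). w j *
     (of_bool (j = 0) + of_bool (0 < i \<and> i < N) * (of_bool (j = N - i) - of_bool (j = N))))"

text \<open>Index 0 belongs to the eigenvalue \<open>w 0\<close>, index \<open>N\<close> to the
  kernel. For \<open>0 < j < N\<close>, \<open>A\<close> maps \<open>e_j\<close> to
  \<open>w j * e_(N-j)\<close>, so a pair \<open>j\<close>, \<open>N - j\<close> spans an invariant
  plane, with \<open>s\<close> assigned to the smaller index and \<open>- s\<close> to the larger; a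
  fixed index \<open>j = N - j\<close> gives an eigenvector by itself.\<close>

definition eigvec :: "nat \<Rightarrow> 'a vec" where
  "eigvec j =
    (if j = 0 then vec (Suc N) (\<lambda>i. if i = 0 \<or> i = N then 1 else 1 + w (N - i) / w 0)
     else if j = N then vec (Suc N) (\<lambda>i. if i = 0 then 0 else w N / w i)
     else if j = N - j then unit_vec (Suc N) j
     else if j < N - j then w (N - j) \<cdot>\<^sub>v unit_vec (Suc N) j + s \<cdot>\<^sub>v unit_vec (Suc N) (N - j)
     else w (N - j) \<cdot>\<^sub>v unit_vec (Suc N) j - s \<cdot>\<^sub>v unit_vec (Suc N) (N - j))"

definition eigval :: "nat \<Rightarrow> 'a" where
  "eigval j = (if j = 0 then w 0 else if j = N then 0 else if j = N - j then w j
     else if j < N - j then s else - s)"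

lemma A_carrier: "A \<in> carrier_mat (Suc N) (Suc N)"
  by (simp add: A_def)

lemma eigvec_carrier: "eigvec j \<in> carrier_vec (Suc N)"
  by (simp add: eigvec_def)

lemma s_nz: "s \<noteq> 0"
  using w_w[of 0] w_nz[of 0] w_nz[of N] by auto

lemma A_mult_vec:
  assumes "x \<in> carrier_vec (Suc N)" and "i \<le> N"
  shows "(A *\<^sub>v x) $ i =
    w 0 * x $ 0 + (if 0 < i \<and> i < N then w (N - i) * x $ (N - i) - w N * x $ N else 0)"
proof -
  have "(A *\<^sub>v x) $ i = (\<Sum>j\<le>N. w j *
     (of_bool (j = 0) + of_bool (0 < i \<and> i < N) * (of_bool (j = N - i) - of_bool (j = N))) * x $ j)"
    using assms by (simp add: A_def scalar_prod_def atLeast0_lessThan_Suc lessThan_Suc_atMost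
        flip: lessThan_atLeast0)
  also have "\<dots> = (\<Sum>j\<le>N. (if j = 0 then w j * x $ j else 0) + of_bool (0 < i \<and> i < N) *
      ((if j = N - i then w j * x $ j else 0) - (if j = N then w j * x $ j else 0)))"
    by (intro sum.cong) (auto simp: algebra_simps)
  also have "\<dots> = w 0 * x $ 0 + of_bool (0 < i \<and> i < N) * (w (N - i) * x $ (N - i) - w N * x $ N)"
    using assms N by (simp add: sum.distrib sum_subtractf flip: sum_distrib_left)
  finally show ?thesis
    by auto
qed

lemma A_mult_eigvec:
  assumes "j \<le> N"
  shows "A *\<^sub>v eigvec j = eigval j \<cdot>\<^sub>v eigvec j"
proof (rule eq_vecI)
  fix i assume "i < dim_vec (eigval j \<cdot>\<^sub>v eigvec j)"
  hence i: "i \<le> N"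
    using eigvec_carrier[of j] by auto
  have eq: "(A *\<^sub>v eigvec j) $ i = w 0 * eigvec j $ 0 +
      (if 0 < i \<and> i < N then w (N - i) * eigvec j $ (N - i) - w N * eigvec j $ N else 0)"
    by (rule A_mult_vec[OF eigvec_carrier i])
  have R: "(eigval j \<cdot>\<^sub>v eigvec j) $ i = eigval j * eigvec j $ i"
    using i eigvec_carrier[of j] by auto
  consider "j = 0" | "j = N" "j \<noteq> 0" | "0 < j" "j < N" "j = N - j"
    | "0 < j" "j < N" "j < N - j" | "0 < j" "j < N" "N - j < j"
    using assms by linarith
  thus "(A *\<^sub>v eigvec j) $ i = (eigval j \<cdot>\<^sub>v eigvec j) $ i"
  proof cases
    case 1
    \<comment> \<open>Row \<open>i\<close> comes down to \<open>w i * w (N - i) = w 0 * w N\<close>;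
      both sides are \<open>s ^ 2\<close>.\<close>
    show ?thesis
      unfolding eq R using 1 i w_w[of i] w_w[of 0] w_nz[of 0]
      by (auto simp: eigvec_def eigval_def field_simps)
  next
    case 2
    show ?thesis
      unfolding eq R using 2 i w_nz by (auto simp: eigvec_def eigval_def field_simps)
  next
    case 3
    show ?thesis
      unfolding eq R using 3 i by (auto simp: eigvec_def eigval_def unit_vec_def)
  next
    case 4
    show ?thesis
      unfolding eq R using 4 i w_w[of j]
      by (auto simp: eigvec_def eigval_def unit_vec_def power2_eq_square mult_ac)
  next
    case 5
    show ?thesis
      unfolding eq R using 5 i w_w[of j]
      by (auto simp: eigvec_def eigval_def unit_vec_def power2_eq_square mult_ac)
  qed
qed (use A_carrier eigvec_carrier[of j] in auto)

text \<open>Orthogonality to the two eigenvectors of a pair is a linear system with determinant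
  \<open>w i * w (N - i) + s ^ 2 = 2 * s ^ 2\<close>. Once the inner coordinates vanish,
  \<open>eigvec N\<close> gives \<open>u $ N = 0\<close> and then \<open>eigvec 0\<close> gives
  \<open>u $ 0 = 0\<close>.\<close>

lemma eigvec_spans:
  assumes char: "(2 :: 'a) \<noteq> 0 \<or> N \<le> 2"
    and u: "u \<in> carrier_vec (Suc N)"
    and orth: "\<And>j. j < Suc N \<Longrightarrow> eigvec j \<bullet> u = 0"
  shows "u = 0\<^sub>v (Suc N)"
proof -
  have pair: "u $ i = 0 \<and> u $ (N - i) = 0" if "0 < i" "i < N - i" for i
  proof -
    have "eigvec i \<bullet> u = w (N - i) * u $ i + s * u $ (N - i)"
      using that u by (auto simp: eigvec_def add_scalar_prod_distrib[of _ "Suc N"])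
    moreover have "eigvec (N - i) \<bullet> u = w i * u $ (N - i) - s * u $ i"
      using that u by (auto simp: eigvec_def minus_scalar_prod_distrib[of _ "Suc N"])
    ultimately have e1: "w (N - i) * u $ i = - (s * u $ (N - i))"
      and e2: "w i * u $ (N - i) = s * u $ i"
      using orth[of i] orth[of "N - i"] that by (auto simp: add_eq_0_iff2)
    have "s ^ 2 * u $ i = w i * (w (N - i) * u $ i)"
      using w_w[of i] that by simp
    also have "\<dots> = - s * (w i * u $ (N - i))"
      by (simp add: e1)
    also have "\<dots> = - (s ^ 2 * u $ i)"
      by (simp add: e2 power2_eq_square)
    finally have "2 * (s ^ 2 * u $ i) = 0"
      by (metis add.right_inverse mult_2)
    \<comment> \<open>\<open>0 < i < N - i\<close> forces \<open>3 \<le> N\<close>, which leaves the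
      first alternative of \<open>char\<close>.\<close>
    moreover have "(2 :: 'a) \<noteq> 0"
      using char that by auto
    ultimately have "u $ i = 0"
      using s_nz by simp
    with e2 w_nz[of i] show ?thesis
      by simp
  qed
  have mid: "u $ i = 0" if "0 < i" "i < N" for i
  proof -
    consider "i < N - i" | "N - i < i" | "i = N - i"
      by linarith
    thus ?thesis
    proof cases
      case 3
      hence "eigvec i \<bullet> u = u $ i"
        using that u by (auto simp: eigvec_def)
      thus ?thesis
        using orth[of i] that by simp
    qed (use pair[of i] pair[of "N - i"] that in auto)
  qed
  have dot: "x \<bullet> u = x $ 0 * u $ 0 + x $ N * u $ N" for x
  proof -
    have "x \<bullet> u = (\<Sum>i\<le>N. x $ i * u $ i)"
      using u by (simp add: scalar_prod_def atLeast0_lessThan_Suc lessThan_Suc_atMost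
          flip: lessThan_atLeast0)
    also have "\<dots> = (\<Sum>i\<in>{0, N}. x $ i * u $ i)"
      by (rule sum.mono_neutral_right) (use mid N in auto)
    finally show ?thesis
      using N by simp
  qed
  have "u $ N = 0"
    using orth[of N] dot[of "eigvec N"] N w_nz[of N] by (auto simp: eigvec_def)
  moreover from this have "u $ 0 = 0"
    using orth[of 0] dot[of "eigvec 0"] N by (auto simp: eigvec_def)
  ultimately have "u $ i = 0" if "i \<le> N" for i
    using mid[of i] that by (cases "i = 0 \<or> i = N") auto
  thus ?thesis
    using u by (intro eq_vecI) auto
qed

lemma A_diagonalizable_iff: "diagonalizable_mat A \<longleftrightarrow> (2 :: 'a) \<noteq> 0 \<or> N \<le> 2"
proof
  assume "(2 :: 'a) \<noteq> 0 \<or> N \<le> 2"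
  thus "diagonalizable_mat A"
    by (intro diagonalizable_matI[OF A_carrier, of eigvec eigval] eigvec_carrier A_mult_eigvec
        eigvec_spans) auto
next
  assume diag: "diagonalizable_mat A"
  show "(2 :: 'a) \<noteq> 0 \<or> N \<le> 2"
  proof (rule ccontr)
    assume "\<not> ?thesis"
    hence two: "(2 :: 'a) = 0" and N3: "3 \<le> N"
      by auto
    have neg: "- x = x" for x :: 'a
      using two by (metis add_eq_0_iff mult_2 mult_zero_left)
    \<comment> \<open>\<open>u\<close> is chosen as \<open>A v - s v\<close> for
      \<open>v = e_1\<close>. On the plane of \<open>e_1\<close> and \<open>e_(N-1)\<close> the
      square of \<open>A\<close> is \<open>s ^ 2\<close>, so \<open>A u = - s u\<close>, which is
      \<open>s u\<close> in characteristic 2. \<open>3 \<le> N\<close> keeps 1 and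
      \<open>N - 1\<close> distinct.\<close>
    define v :: "'a vec" where "v = unit_vec (Suc N) 1"
    define u where "u = w 1 \<cdot>\<^sub>v unit_vec (Suc N) (N - 1) - s \<cdot>\<^sub>v unit_vec (Suc N) 1"
    have carr: "v \<in> carrier_vec (Suc N)" "u \<in> carrier_vec (Suc N)"
      by (auto simp: v_def u_def)
    have "A *\<^sub>v v = s \<cdot>\<^sub>v v + u"
    proof (rule eq_vecI)
      fix i assume "i < dim_vec (s \<cdot>\<^sub>v v + u)"
      hence i: "i \<le> N"
        using carr by auto
      show "(A *\<^sub>v v) $ i = (s \<cdot>\<^sub>v v + u) $ i"
        unfolding A_mult_vec[OF carr(1) i] using i N3
        by (auto simp: v_def u_def unit_vec_def)
    qed (use A_carrier carr in auto)
    moreover have "A *\<^sub>v u = s \<cdot>\<^sub>v u"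
    proof (rule eq_vecI)
      fix i assume "i < dim_vec (s \<cdot>\<^sub>v u)"
      hence i: "i \<le> N"
        using carr by auto
      show "(A *\<^sub>v u) $ i = (s \<cdot>\<^sub>v u) $ i"
        unfolding A_mult_vec[OF carr(2) i] using i N3 w_w[of 1]
        by (auto simp: u_def unit_vec_def neg power2_eq_square mult_ac)
    qed (use A_carrier carr in auto)
    ultimately have "u = 0\<^sub>v (Suc N)"
      by (rule diagonalizable_mat_no_jordan_chain[OF diag A_carrier carr])
    moreover have "u $ 1 = - s"
      using N3 by (auto simp: u_def unit_vec_def)
    ultimately show False
      using s_nz N3 by simp
  qed
qed

text \<open>Unless \<open>x = w 0\<close>, rows 0 and \<open>N\<close> make both end coordinates of
  an eigenvector vanish; applying the reversal twice then gives \<open>x ^ 2 = s ^ 2\<close> at a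
  nonzero inner coordinate. The clause \<open>2 \<le> N\<close> records that such a coordinate
  exists.\<close>

lemma nonzero_eigenvalueD:
  assumes "eigenvalue A x" and "x \<noteq> 0"
  shows "x = w 0 \<or> x ^ 2 = s ^ 2 \<and> 2 \<le> N"
proof (rule disjCI)
  assume neg: "\<not> (x ^ 2 = s ^ 2 \<and> 2 \<le> N)"
  obtain z where z: "z \<in> carrier_vec (Suc N)" "z \<noteq> 0\<^sub>v (Suc N)" "A *\<^sub>v z = x \<cdot>\<^sub>v z"
    using assms(1) A_carrier by (auto simp: eigenvalue_def eigenvector_def)
  have eq: "x * z $ i =
      w 0 * z $ 0 + (if 0 < i \<and> i < N then w (N - i) * z $ (N - i) - w N * z $ N else 0)"
    if "i \<le> N" for i
    using A_mult_vec[OF z(1) that] z that by simp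
  show "x = w 0"
  proof (rule ccontr)
    assume "x \<noteq> w 0"
    hence z0: "z $ 0 = 0"
      using eq[of 0] by simp
    hence zN: "z $ N = 0"
      using eq[of N] assms(2) by simp
    have "z $ i = 0" if i: "0 < i" "i < N" for i
    proof -
      have "x ^ 2 * z $ i = x * (w (N - i) * z $ (N - i))"
        using eq[of i] i by (simp add: z0 zN power2_eq_square)
      also have "\<dots> = w (N - i) * (x * z $ (N - i))"
        by simp
      also have "x * z $ (N - i) = w i * z $ i"
        using eq[of "N - i"] i by (simp add: z0 zN)
      also have "w (N - i) * (w i * z $ i) = s ^ 2 * z $ i"
        using w_w[of i] i by (metis mult.assoc mult.commute less_imp_le)
      finally show ?thesis
        using neg i by auto
    qed
    hence "z $ i = 0" if "i \<le> N" for i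
      using that z0 zN by (cases "i = 0 \<or> i = N") auto
    hence "z = 0\<^sub>v (Suc N)"
      using z(1) by (intro eq_vecI) auto
    with z(2) show False
      by simp
  qed
qed

lemma eigenvalue_eigval:
  assumes "j \<le> N"
  shows "eigenvalue A (eigval j)"
proof -
  \<comment> \<open>The \<open>j\<close>-th coordinate is 1 or \<open>w (N - j)\<close>.\<close>
  have "eigvec j $ j \<noteq> 0"
    using assms w_nz by (auto simp: eigvec_def unit_vec_def)
  hence "eigvec j \<noteq> 0\<^sub>v (Suc N)"
    using assms by auto
  thus ?thesis
    using A_mult_eigvec[OF assms] eigvec_carrier A_carrier
    unfolding eigenvalue_def eigenvector_def by auto
qed

text \<open>\<open>eigval 1\<close> is \<open>w 1\<close> if \<open>N = 2\<close> and
  \<open>s\<close> if \<open>N > 2\<close>; it witnesses the slope \<open>k / 2\<close>.\<close>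

lemma eigval_1_square:
  assumes "2 \<le> N"
  shows "eigval 1 ^ 2 = s ^ 2"
  using assms w_w[of 1] by (auto simp: eigval_def power2_eq_square)

end

section \<open>Specialization to the Atkin matrix\<close>

text \<open>Stated for any ring homomorphism \<open>h\<close>, so as to serve both the algebraic
  closure for the slopes and \<open>'c\<close> for diagonalizability. The target must contain a
  square root \<open>s\<close> of \<open>t ^ k\<close>.\<close>

lemma map_atkin_mat:
  fixes h :: "'f :: {field, finite} poly \<Rightarrow> 'a :: field"
  assumes "ring_hom h" and "primepow CARD('f)" and "1 \<le> N" and "N \<le> CARD('f) + 1"
    and "h (Polynomial.monom 1 1) \<noteq> 0"
    and s: "s ^ 2 = h (Polynomial.monom 1 1) ^ (2 + N * (CARD('f) - 1))"
  defines "w \<equiv> (\<lambda>j. h (Polynomial.monom 1 1) ^ (1 + j * (CARD('f) - 1)))"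
  shows "reversal_mat N w s"
    and "map_mat h (atkin_mat (N + 1) CARD('f)) = reversal_mat.A N w"
proof -
  interpret ring_hom h by fact
  show R: "reversal_mat N w s"
  proof
    fix i assume "i \<le> N"
    \<comment> \<open>The exponents of two opposite columns add up to \<open>k\<close>, whatever
      \<open>i\<close> is.\<close>
    hence "1 + i * (CARD('f) - 1) + (1 + (N - i) * (CARD('f) - 1)) = 2 + N * (CARD('f) - 1)"
      by (simp flip: add_mult_distrib)
    thus "w i * w (N - i) = s ^ 2"
      unfolding s w_def by (metis power_add)
  qed (use assms in auto)
  obtain e where char: "Factorial_Ring.prime CHAR('f)" "CARD('f) = CHAR('f) ^ e"
    using CHAR_of_primepow_CARD assms(2) by blast
  have q: "2 \<le> CARD('f)"
    using assms(2) primepow_gt_Suc_0[of "CARD('f)"] by simp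
  have "h (Polynomial.monom (atkin_coeff (N + 1) CARD('f) (i + 1) (j + 1)) (1 + j * (CARD('f) - 1))) =
      w j * (of_bool (j = 0) + of_bool (0 < i \<and> i < N) * (of_bool (j = N - i) - of_bool (j = N)))"
    if "i \<le> N" "j \<le> N" for i j
  proof -
    \<comment> \<open>Indicators are moved out of \<open>monom\<close>, so that the ring
      homomorphism \<open>h\<close> can act on each factor.\<close>
    have monom_of_bool: "Polynomial.monom (of_bool a :: 'f) m = Polynomial.monom 1 m * of_bool a"
      for a m
      by (cases a) auto
    have "Polynomial.monom (of_bool a + of_bool b * (of_bool c - of_bool d) :: 'f) m =
        Polynomial.monom 1 1 ^ m * (of_bool a + of_bool b * (of_bool c - of_bool d))" for a b c d m
      by (cases b) (simp_all add: Polynomial.monom_power monom_of_bool algebra_simps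
          flip: Polynomial.add_monom Polynomial.diff_monom)
    hence "h (Polynomial.monom (of_bool a + of_bool b * (of_bool c - of_bool d) :: 'f) m) =
        h (Polynomial.monom 1 1) ^ m * (of_bool a + of_bool b * (of_bool c - of_bool d))" for a b c d m
      by (simp add: hom_distribs)
    thus ?thesis
      using atkin_coeff_eq[OF char q assms(3,4) that] by (simp add: w_def)
  qed
  thus "map_mat h (atkin_mat (N + 1) CARD('f)) = reversal_mat.A N w"
    by (intro eq_matI) (auto simp: atkin_mat_def reversal_mat.A_def[OF R])
qed

section \<open>Valuations, slopes and the final equivalence\<close>

lemma extends_t_adic_valuation_power:
  assumes "extends_t_adic_valuation v" and "x \<noteq> 0"
  shows "v (x ^ m) = real m * v x"
proof (induction m)
  case 0
  have "v (1 * 1) = v 1 + v 1"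
    using assms(1) unfolding extends_t_adic_valuation_def by (metis one_neq_zero)
  thus ?case
    by simp
next
  case (Suc m)
  have "v (x * x ^ m) = v x + v (x ^ m)"
    using assms unfolding extends_t_adic_valuation_def by simp
  with Suc show ?case
    by (simp add: algebra_simps)
qed

theorem corollary5p7:
  fixes q n k :: nat
    and v :: "'f :: {field, finite} poly fract alg_closure \<Rightarrow> real"
    and \<iota> :: "'f fls alg_closure \<Rightarrow> 'c :: {field, complete_space}"
  assumes "primepow q"
    and "CARD('f) = q"
    and "2 \<le> n" and "n \<le> q + 2"
    and "k = 2 + (n - 1) * (q - 1)"
    and "extends_t_adic_valuation v"
    and "is_C_infty \<iota>"
  shows "slopes v (atkin_mat n q) = (if n = 2 then {1} else {1, real k / 2}) \<and>
    (diagonalizable_mat (map_mat (poly_to_C_infty \<iota>) (atkin_mat n q))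
       \<longleftrightarrow> odd q \<or> (even q \<and> n \<le> 3))"
proof
  define N where "N = n - 1"
  have n: "n = N + 1" and N: "1 \<le> N" "N \<le> CARD('f) + 1" and pp: "primepow CARD('f)"
    and k: "k = 2 + N * (CARD('f) - 1)"
    using assms by (auto simp: N_def)

  show "slopes v (atkin_mat n q) = (if n = 2 then {1} else {1, real k / 2})"
  proof -
    define h :: "'f poly \<Rightarrow> 'f poly fract alg_closure" where "h = (\<lambda>a. to_ac (to_fract a))"
    define t where "t = h (Polynomial.monom 1 1)"
    have hom: "ring_hom h"
      by standard (auto simp: h_def)
    have t: "t \<noteq> 0"
      by (simp add: t_def h_def Polynomial.monom_eq_0_iff)
    obtain s where s: "s ^ 2 = t ^ k"
      using nth_root_exists[of 2 "t ^ k"] by auto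
    define w where "w = (\<lambda>j. t ^ (1 + j * (CARD('f) - 1)))"
    note M = map_atkin_mat[OF hom pp N t[unfolded t_def] s[unfolded t_def k],
        folded t_def, folded w_def]
    interpret reversal_mat N w s
      by (rule M(1))
    have w0: "w 0 = t"
      by (simp add: w_def)
    have vt: "v t = 1"
    proof -
      have "v (to_ac (Fract (Polynomial.monom 1 1) 1)) =
          real (Polynomial.order 0 (Polynomial.monom (1 :: 'f) 1)) - real (Polynomial.order 0 (1 :: 'f poly))"
        using assms(6) unfolding extends_t_adic_valuation_def
        by (metis Polynomial.monom_eq_0_iff one_neq_zero)
      also have "\<dots> = 1"
        by (simp add: order_0_monom)
      finally show ?thesis
        by (simp add: t_def h_def to_fract_def)
    qed
    \<comment> \<open>Either square root of \<open>t ^ k\<close> has valuation \<open>k / 2\<close>,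
      whichever extension \<open>v\<close> is.\<close>
    have v_sqrt: "v x = real k / 2" if "x ^ 2 = s ^ 2" for x
    proof -
      have "x \<noteq> 0"
        using that s_nz by auto
      hence "2 * v x = v (t ^ k)"
        using extends_t_adic_valuation_power[OF assms(6), of x 2] that s by simp
      also have "\<dots> = real k"
        using extends_t_adic_valuation_power[OF assms(6) t] vt by simp
      finally show ?thesis
        by simp
    qed
    have sl: "slopes v (atkin_mat n q) = {v x |x. eigenvalue A x \<and> x \<noteq> 0}"
      using M(2) by (simp add: slopes_def n assms(2) flip: h_def)
    have mem1: "1 \<in> slopes v (atkin_mat n q)"
      using eigenvalue_eigval[of 0] vt t by (auto simp: sl eigval_def w0)
    have mem2: "real k / 2 \<in> slopes v (atkin_mat n q)" if "2 \<le> N"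
    proof -
      have "eigval 1 \<noteq> 0"
        using eigval_1_square[OF that] s_nz by auto
      thus ?thesis
        using eigenvalue_eigval[of 1] v_sqrt[OF eigval_1_square[OF that]] N by (force simp: sl)
    qed
    have only: "y = 1 \<or> y = real k / 2 \<and> 2 \<le> N" if "y \<in> slopes v (atkin_mat n q)" for y
      using that nonzero_eigenvalueD vt v_sqrt by (auto simp: sl w0)
    show ?thesis
    \<comment> \<open>\<open>N = 1\<close> is \<open>n = 2\<close>: the middle block is empty and
      \<open>t\<close> is the only nonzero eigenvalue.\<close>
    proof (cases "N = 1")
      case True
      hence "slopes v (atkin_mat n q) = {1}"
        using mem1 only by fastforce
      thus ?thesis
        using True by (simp add: n)
    next
      case False
      hence "slopes v (atkin_mat n q) = {1, real k / 2}"
        using mem1 mem2 only N(1) by fastforce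
      thus ?thesis
        using False by (simp add: n)
    qed
  qed

  show "diagonalizable_mat (map_mat (poly_to_C_infty \<iota>) (atkin_mat n q))
       \<longleftrightarrow> odd q \<or> (even q \<and> n \<le> 3)"
  proof -
    interpret \<iota>: field_hom \<iota>
      using assms(7) by (simp add: is_C_infty_def)
    define h where "h = poly_to_C_infty \<iota>"
    define t where "t = h (Polynomial.monom 1 1)"
    interpret const: map_poly_comm_ring_hom "fls_const :: 'f \<Rightarrow> 'f fls"
      by standard (auto simp: fls_plus_const)
    have hom: "ring_hom h"
      by standard (auto simp: h_def poly_to_C_infty_def hom_distribs)
    have t_eq: "t = \<iota> (to_ac fls_X_inv)"
      by (simp add: t_def h_def poly_to_C_infty_def map_poly_monom poly_monom)
    have t: "t \<noteq> 0"
      by (simp add: t_eq)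
    \<comment> \<open>The root of \<open>t ^ k\<close> is taken in the algebraic closure of the
      Laurent series field and carried to \<open>'c\<close> by \<open>\<iota>\<close>.\<close>
    obtain r where r: "r ^ 2 = (to_ac fls_X_inv :: 'f fls alg_closure) ^ k"
      using nth_root_exists[of 2] by auto
    have s: "\<iota> r ^ 2 = t ^ k"
      unfolding t_eq using r by (metis \<iota>.hom_power)
    define w where "w = (\<lambda>j. t ^ (1 + j * (CARD('f) - 1)))"
    note M = map_atkin_mat[OF hom pp N t[unfolded t_def] s[unfolded t_def k],
        folded t_def, folded w_def]
    interpret reversal_mat N w "\<iota> r"
      by (rule M(1))
    \<comment> \<open>Through the embedding, \<open>'c\<close> inherits the characteristic of
      \<open>'f\<close>, which is 2 exactly when \<open>q\<close> is even.\<close>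
    have "(2 :: 'c) = 0 \<longleftrightarrow> even q"
    proof -
      have "(2 :: 'c) = \<iota> (to_ac (fls_const 2))"
        by (metis \<iota>.hom_numeral fls_const_numeral to_ac_numeral)
      hence "(2 :: 'c) = 0 \<longleftrightarrow> fls_const (2 :: 'f) = 0"
        by (simp only: \<iota>.hom_0_iff to_ac_eq_0_iff)
      also have "\<dots> \<longleftrightarrow> of_nat 2 = (0 :: 'f)"
        by (metis fls_const_0 fls_const_nonzero of_nat_numeral)
      also have "\<dots> \<longleftrightarrow> CHAR('f) dvd 2"
        by (rule of_nat_eq_0_iff_char_dvd)
      also have "\<dots> \<longleftrightarrow> even q"
      proof -
        obtain e where "Factorial_Ring.prime CHAR('f)" "CARD('f) = CHAR('f) ^ e"
          using CHAR_of_primepow_CARD pp by blast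
        thus ?thesis
          using pp assms(2) primepow_gt_Suc_0[OF pp]
          by (metis dvd_refl even_power primes_dvd_imp_eq two_is_prime_nat
              power_0 less_irrefl One_nat_def neq0_conv)
      qed
      finally show ?thesis .
    qed
    thus ?thesis
      using A_diagonalizable_iff M(2) by (auto simp: n assms(2) simp flip: h_def)
  qed
qed

end
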